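(* Let $d\in\mathbb{N}$. Let $\Omega_1,\Omega_2$ be sets, let $\mathcal{S}_1,\mathcal{S}_2$ be vector spaces of real-valued functions on $\Omega_1$ and $\Omega_2$ containing the unit constant functions, and let $\mathcal{E}\colon\mathcal{S}_1\to\mathcal{S}_2$ be a Markov operator. Let $\mathcal{X}=\mathbb{R}^d$, $\mathcal{Y}=\mathbb{R}$, and let $\mathcal{E}^{\mathcal{X}}\colon\mathcal{S}_1^{\mathcal{X}}\to\mathcal{S}_2^{\mathcal{X}}$ and $\mathcal{E}^{\mathcal{Y}}\colon\mathcal{S}_1^{\mathcal{Y}}\to\mathcal{S}_2^{\mathcal{Y}}$ be an $\mathcal{X}$-valued and a $\mathcal{Y}$-valued Markov operator, respectively, both associated with the same Markov operator $\mathcal{E}$. Let $f\colon\mathbb{R}^d\to\mathbb{R}$ be a convex function and let $X\colon\Omega_1\to\mathbb{R}^d$ be such that $(X,f(X))\in\mathcal{S}_1^{\mathcal{X}}\times\mathcal{S}_1^{\mathcal{Y}}$. Then $$\mathcal{E}^{\mathcal{Y}}(f(X))\geq f(\mathcal{E}^{\mathcal{X}}(X))$$ pointwise on $\Omega_2$.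
   Context: Markov operators: a linear operator $\mathcal{E}\colon\mathcal{S}_1\to\mathcal{S}_2$ is a Markov operator if (i) $\mathcal{E}(\mathbf{1}_{\Omega_1})=\mathbf{1}_{\Omega_2}$, where $\mathbf{1}_{\Omega_i}$ is the constant function $1$ on $\Omega_i$, and (ii) $\mathcal{E}(\varphi)\geq0$ for each $\varphi\in\mathcal{S}_1$ with $\varphi\geq0$ (pointwise). For a real topological vector space $\mathcal{Z}$ with continuous dual $\mathcal{Z}'$, let, for $i=1,2$, $\mathcal{S}_i^{\mathcal{Z}}$ be any subset of $\{Z_i\colon\Omega_i\to\mathcal{Z}\mid \ell(Z_i)=\ell\circ Z_i\in\mathcal{S}_i\text{ for each }\ell\in\mathcal{Z}'\}$. A map $\mathcal{E}^{\mathcal{Z}}\colon\mathcal{S}_1^{\mathcal{Z}}\to\mathcal{S}_2^{\mathcal{Z}}$ is a $\mathcal{Z}$-valued Markov operator associated with $\mathcal{E}$ if $\ell(\mathcal{E}^{\mathcal{Z}}(Z_1))=\mathcal{E}(\ell(Z_1))$ for each $\ell\in\mathcal{Z}'$ and $Z_1\in\mathcal{S}_1^{\mathcal{Z}}$. The sets $\mathcal{S}_i^{\mathcal{X}},\mathcal{S}_i^{\mathcal{Y}}$ are of this form with $\mathcal{Z}=\mathcal{X},\mathcal{Y}$. No measurability or integrability is assumed. $f(X)$ denotes $f\circ X$. *)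

theory Defs
  imports "HOL-Analysis.Analysis"
begin

text \<open>Functions on a set \<open>\<Omega>\<close> are represented by the functions in \<^term>\<open>extensional \<Omega>\<close>, so that
  HOL equality of two such functions is equality on \<open>\<Omega>\<close>. Pointwise operations and composition
  are restricted to \<open>\<Omega>\<close> accordingly; \<open>compose \<Omega> g Z\<close> is the function \<open>g \<circ> Z\<close> on \<open>\<Omega>\<close>.\<close>

definition real_function_space :: "'a set \<Rightarrow> ('a \<Rightarrow> real) set \<Rightarrow> bool" where
  "real_function_space \<Omega> S \<longleftrightarrow>
     S \<subseteq> extensional \<Omega> \<and>
     (\<lambda>\<omega>\<in>\<Omega>. 0) \<in> S \<and>
     (\<forall>\<phi>\<in>S. \<forall>\<psi>\<in>S. (\<lambda>\<omega>\<in>\<Omega>. \<phi> \<omega> + \<psi> \<omega>) \<in> S) \<and>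
     (\<forall>c. \<forall>\<phi>\<in>S. (\<lambda>\<omega>\<in>\<Omega>. c * \<phi> \<omega>) \<in> S)"

definition linear_operator ::
    "'a set \<Rightarrow> ('a \<Rightarrow> real) set \<Rightarrow> 'b set \<Rightarrow> ('b \<Rightarrow> real) set \<Rightarrow>
     (('a \<Rightarrow> real) \<Rightarrow> ('b \<Rightarrow> real)) \<Rightarrow> bool" where
  "linear_operator \<Omega>\<^sub>1 S\<^sub>1 \<Omega>\<^sub>2 S\<^sub>2 E \<longleftrightarrow>
     E \<in> S\<^sub>1 \<rightarrow> S\<^sub>2 \<and>
     (\<forall>\<phi>\<in>S\<^sub>1. \<forall>\<psi>\<in>S\<^sub>1. E (\<lambda>\<omega>\<in>\<Omega>\<^sub>1. \<phi> \<omega> + \<psi> \<omega>) = (\<lambda>\<omega>\<in>\<Omega>\<^sub>2. E \<phi> \<omega> + E \<psi> \<omega>)) \<and>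
     (\<forall>c. \<forall>\<phi>\<in>S\<^sub>1. E (\<lambda>\<omega>\<in>\<Omega>\<^sub>1. c * \<phi> \<omega>) = (\<lambda>\<omega>\<in>\<Omega>\<^sub>2. c * E \<phi> \<omega>))"

definition markov_operator ::
    "'a set \<Rightarrow> ('a \<Rightarrow> real) set \<Rightarrow> 'b set \<Rightarrow> ('b \<Rightarrow> real) set \<Rightarrow>
     (('a \<Rightarrow> real) \<Rightarrow> ('b \<Rightarrow> real)) \<Rightarrow> bool" where
  "markov_operator \<Omega>\<^sub>1 S\<^sub>1 \<Omega>\<^sub>2 S\<^sub>2 E \<longleftrightarrow>
     linear_operator \<Omega>\<^sub>1 S\<^sub>1 \<Omega>\<^sub>2 S\<^sub>2 E \<and>
     E (\<lambda>\<omega>\<in>\<Omega>\<^sub>1. 1) = (\<lambda>\<omega>\<in>\<Omega>\<^sub>2. 1) \<and>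
     (\<forall>\<phi>\<in>S\<^sub>1. (\<forall>\<omega>\<in>\<Omega>\<^sub>1. 0 \<le> \<phi> \<omega>) \<longrightarrow> (\<forall>\<omega>\<in>\<Omega>\<^sub>2. 0 \<le> E \<phi> \<omega>))"

text \<open>The libraries have no type class of real topological vector spaces. The notions below only
  refer to the linear structure and the topology, so they are stated for any type carrying both;
  compatibility of the two is not needed to state them.\<close>

definition continuous_dual :: "('z::{real_vector,topological_space} \<Rightarrow> real) set" where
  "continuous_dual = {l. linear l \<and> continuous_on UNIV l}"

text \<open>The largest admissible class of \<open>\<Z>\<close>-valued functions for a given \<open>S\<close>.\<close>

definition weak_functions ::
    "'a set \<Rightarrow> ('a \<Rightarrow> real) set \<Rightarrow> ('a \<Rightarrow> 'z::{real_vector,topological_space}) set" where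
  "weak_functions \<Omega> S =
     {Z \<in> extensional \<Omega>. \<forall>l\<in>continuous_dual. compose \<Omega> l Z \<in> S}"

definition vector_markov_operator ::
    "'a set \<Rightarrow> ('a \<Rightarrow> real) set \<Rightarrow> ('a \<Rightarrow> 'z) set \<Rightarrow>
     'b set \<Rightarrow> ('b \<Rightarrow> real) set \<Rightarrow> ('b \<Rightarrow> 'z) set \<Rightarrow>
     (('a \<Rightarrow> real) \<Rightarrow> ('b \<Rightarrow> real)) \<Rightarrow>
     (('a \<Rightarrow> 'z::{real_vector,topological_space}) \<Rightarrow> ('b \<Rightarrow> 'z)) \<Rightarrow> bool" where
  "vector_markov_operator \<Omega>\<^sub>1 S\<^sub>1 S\<^sub>1Z \<Omega>\<^sub>2 S\<^sub>2 S\<^sub>2Z E EZ \<longleftrightarrow>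
     S\<^sub>1Z \<subseteq> weak_functions \<Omega>\<^sub>1 S\<^sub>1 \<and>
     S\<^sub>2Z \<subseteq> weak_functions \<Omega>\<^sub>2 S\<^sub>2 \<and>
     EZ \<in> S\<^sub>1Z \<rightarrow> S\<^sub>2Z \<and>
     (\<forall>l\<in>continuous_dual. \<forall>Z\<in>S\<^sub>1Z. compose \<Omega>\<^sub>2 l (EZ Z) = E (compose \<Omega>\<^sub>1 l Z))"

end

theory Submission imports Defs begin

text \<open>Jensen's inequality for Markov operators follows from the supporting affine function of \<open>f\<close> at
  a single point. Fix \<open>\<omega>\<close> in \<open>\<Omega>\<^sub>2\<close> and put \<open>p = E\<^sub>X X \<omega>\<close>. A finite convex function on a Euclidean
  space has a subgradient \<open>v\<close> at \<open>p\<close> (\<open>convex_on_UNIV_subgradient\<close>), so that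
  \<open>f p - v \<bullet> p + v \<bullet> X \<le> f \<circ> X\<close> on \<open>\<Omega>\<^sub>1\<close>. The operator \<open>E\<close> is monotone and sends \<open>c + \<phi>\<close> to
  \<open>c + E \<phi>\<close>, so applying it and evaluating at \<open>\<omega>\<close> gives
  \<open>f p - v \<bullet> p + E (v \<bullet> X) \<omega> \<le> E (f \<circ> X) \<omega>\<close>. Since \<open>v \<bullet> _\<close> and the identity of \<open>\<real>\<close> are continuous
  linear functionals, \<open>E (v \<bullet> X) \<omega> = v \<bullet> p\<close> and \<open>E (f \<circ> X) = E\<^sub>Y (f \<circ> X)\<close>. The left-hand side is
  thus \<open>f p\<close>. The argument works pointwise in \<open>\<omega>\<close>, so no measurability is needed.\<close>

text \<open>The subgradient is read off from a hyperplane separating the epigraph of \<open>f\<close> from the open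
  vertical ray below \<open>(p, f p)\<close>. The hyperplane cannot be vertical because \<open>f\<close> is finite
  everywhere.\<close>

lemma convex_on_UNIV_subgradient:
  fixes f :: "'n::euclidean_space \<Rightarrow> real"
  assumes "convex_on UNIV f"
  obtains v where "\<And>x. f p + v \<bullet> (x - p) \<le> f x"
proof -
  let ?R = "{p} \<times> {..< f p}"
  have "convex (epigraph UNIV f)"
    using assms by (rule convex_epigraphI)
  moreover have "convex ?R"
    by (intro convex_Times convex_singleton convex_real_interval)
  moreover have "(p, f p) \<in> epigraph UNIV f" "(p, f p - 1) \<in> ?R"
    by (auto simp: mem_epigraph)
  moreover have "?R \<inter> epigraph UNIV f = {}"
    by (auto simp: epigraph_def)
  ultimately obtain a b where "a \<noteq> 0" and below: "\<And>z. z \<in> ?R \<Longrightarrow> a \<bullet> z \<le> b"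
      and above: "\<And>z. z \<in> epigraph UNIV f \<Longrightarrow> b \<le> a \<bullet> z"
    using separating_hyperplane_sets[of ?R "epigraph UNIV f"] by blast
  obtain u s where a: "a = (u, s)"
    by (cases a)
  have sep: "u \<bullet> p + s * r \<le> u \<bullet> x + s * f x" if "r < f p" for r x
    using below[of "(p, r)"] above[of "(x, f x)"] that by (simp add: a mem_epigraph)
  have "s > 0"
  proof -
    have "s \<ge> 0"
      using sep[of "f p - 1" p] by (simp add: algebra_simps)
    moreover have "s \<noteq> 0"
    proof
      assume "s = 0"
      \<comment> \<open>A vertical hyperplane would make \<open>u \<bullet> _\<close> minimal at \<open>p\<close>, which fails at \<open>p - u\<close>.\<close>
      with sep[of "f p - 1" "p - u"] have "u = 0"
        by (simp add: inner_diff_right) (metis inner_gt_zero_iff not_le)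
      with \<open>s = 0\<close> \<open>a \<noteq> 0\<close> a show False
        by (simp add: zero_prod_def)
    qed
    ultimately show ?thesis by simp
  qed
  have "f p + (- (1 / s) *\<^sub>R u) \<bullet> (x - p) \<le> f x" for x
  proof (rule dense_le)
    fix t assume "t < f p + (- (1 / s) *\<^sub>R u) \<bullet> (x - p)"
    then have "t + (u \<bullet> (x - p)) / s < f p"
      by simp
    from sep[OF this, of x] \<open>s > 0\<close> have "s * t \<le> s * f x"
      by (simp add: distrib_left inner_diff_right)
    with \<open>s > 0\<close> show "t \<le> f x"
      by simp
  qed
  then show thesis by (rule that)
qed

lemma real_function_space_add:
  "real_function_space \<Omega> S \<Longrightarrow> \<phi> \<in> S \<Longrightarrow> \<psi> \<in> S \<Longrightarrow> (\<lambda>\<omega>\<in>\<Omega>. \<phi> \<omega> + \<psi> \<omega>) \<in> S"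
  by (simp add: real_function_space_def)

lemma real_function_space_scale:
  "real_function_space \<Omega> S \<Longrightarrow> \<phi> \<in> S \<Longrightarrow> (\<lambda>\<omega>\<in>\<Omega>. c * \<phi> \<omega>) \<in> S"
  by (simp add: real_function_space_def)

lemma linear_operator_add:
  assumes "linear_operator \<Omega>\<^sub>1 S\<^sub>1 \<Omega>\<^sub>2 S\<^sub>2 E" "\<phi> \<in> S\<^sub>1" "\<psi> \<in> S\<^sub>1" "\<omega> \<in> \<Omega>\<^sub>2"
  shows "E (\<lambda>\<omega>\<in>\<Omega>\<^sub>1. \<phi> \<omega> + \<psi> \<omega>) \<omega> = E \<phi> \<omega> + E \<psi> \<omega>"
  using assms by (simp add: linear_operator_def)

lemma linear_operator_scale:
  assumes "linear_operator \<Omega>\<^sub>1 S\<^sub>1 \<Omega>\<^sub>2 S\<^sub>2 E" "\<phi> \<in> S\<^sub>1" "\<omega> \<in> \<Omega>\<^sub>2"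
  shows "E (\<lambda>\<omega>\<in>\<Omega>\<^sub>1. c * \<phi> \<omega>) \<omega> = c * E \<phi> \<omega>"
  using assms by (simp add: linear_operator_def)

lemma markov_operator_mono:
  assumes S: "real_function_space \<Omega>\<^sub>1 S\<^sub>1"
    and E: "markov_operator \<Omega>\<^sub>1 S\<^sub>1 \<Omega>\<^sub>2 S\<^sub>2 E"
    and \<phi>: "\<phi> \<in> S\<^sub>1" and \<psi>: "\<psi> \<in> S\<^sub>1"
    and le: "\<And>\<omega>. \<omega> \<in> \<Omega>\<^sub>1 \<Longrightarrow> \<phi> \<omega> \<le> \<psi> \<omega>"
    and \<omega>: "\<omega> \<in> \<Omega>\<^sub>2"
  shows "E \<phi> \<omega> \<le> E \<psi> \<omega>"
proof -
  have lin: "linear_operator \<Omega>\<^sub>1 S\<^sub>1 \<Omega>\<^sub>2 S\<^sub>2 E"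
    using E by (simp add: markov_operator_def)
  let ?m = "\<lambda>\<omega>\<in>\<Omega>\<^sub>1. (- 1) * \<phi> \<omega>"
  let ?d = "\<lambda>\<omega>\<in>\<Omega>\<^sub>1. \<psi> \<omega> + ?m \<omega>"
  have m: "?m \<in> S\<^sub>1"
    by (rule real_function_space_scale[OF S \<phi>])
  have d: "?d \<in> S\<^sub>1"
    by (rule real_function_space_add[OF S \<psi> m])
  have "\<forall>\<omega>\<in>\<Omega>\<^sub>1. 0 \<le> ?d \<omega>"
    using le by simp
  with E d \<omega> have "0 \<le> E ?d \<omega>"
    unfolding markov_operator_def by blast
  also have "E ?d \<omega> = E \<psi> \<omega> + E ?m \<omega>"
    by (rule linear_operator_add[OF lin \<psi> m \<omega>])
  also have "E ?m \<omega> = (- 1) * E \<phi> \<omega>"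
    by (rule linear_operator_scale[OF lin \<phi> \<omega>])
  finally show ?thesis by simp
qed

lemma markov_operator_const:
  assumes "(\<lambda>\<omega>\<in>\<Omega>\<^sub>1. 1) \<in> S\<^sub>1" and E: "markov_operator \<Omega>\<^sub>1 S\<^sub>1 \<Omega>\<^sub>2 S\<^sub>2 E" and "\<omega> \<in> \<Omega>\<^sub>2"
  shows "E (\<lambda>\<omega>\<in>\<Omega>\<^sub>1. c) \<omega> = c"
proof -
  have "(\<lambda>\<omega>\<in>\<Omega>\<^sub>1. c) = (\<lambda>\<omega>\<in>\<Omega>\<^sub>1. c * (\<lambda>\<omega>\<in>\<Omega>\<^sub>1. 1) \<omega>)"
    by (auto simp: restrict_def)
  then show ?thesis
    using assms linear_operator_scale[of \<Omega>\<^sub>1 S\<^sub>1 \<Omega>\<^sub>2 S\<^sub>2 E "\<lambda>\<omega>\<in>\<Omega>\<^sub>1. 1" \<omega> c]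
    by (simp add: markov_operator_def)
qed

lemma real_function_space_const:
  assumes "real_function_space \<Omega> S" "(\<lambda>\<omega>\<in>\<Omega>. 1) \<in> S"
  shows "(\<lambda>\<omega>\<in>\<Omega>. c) \<in> S"
proof -
  have "(\<lambda>\<omega>\<in>\<Omega>. c) = (\<lambda>\<omega>\<in>\<Omega>. c * (\<lambda>\<omega>\<in>\<Omega>. 1) \<omega>)"
    by (auto simp: restrict_def)
  then show ?thesis
    using real_function_space_scale[OF assms, of c] by simp
qed

lemma inner_in_continuous_dual: "(\<bullet>) v \<in> continuous_dual"
  for v :: "'z::real_inner"
  unfolding continuous_dual_def
  by (auto intro!: bounded_linear.linear bounded_linear_inner_right continuous_intros)

lemma vector_markov_operator_functional:
  assumes EZ: "vector_markov_operator \<Omega>\<^sub>1 S\<^sub>1 S\<^sub>1Z \<Omega>\<^sub>2 S\<^sub>2 S\<^sub>2Z E EZ"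
    and "l \<in> continuous_dual" "Z \<in> S\<^sub>1Z"
  shows "compose \<Omega>\<^sub>1 l Z \<in> S\<^sub>1"
    and "\<omega> \<in> \<Omega>\<^sub>2 \<Longrightarrow> E (compose \<Omega>\<^sub>1 l Z) \<omega> = l (EZ Z \<omega>)"
proof -
  show "compose \<Omega>\<^sub>1 l Z \<in> S\<^sub>1"
    using assms by (auto simp: vector_markov_operator_def weak_functions_def)
  have "compose \<Omega>\<^sub>2 l (EZ Z) = E (compose \<Omega>\<^sub>1 l Z)"
    using assms by (simp add: vector_markov_operator_def)
  then show "E (compose \<Omega>\<^sub>1 l Z) \<omega> = l (EZ Z \<omega>)" if "\<omega> \<in> \<Omega>\<^sub>2"
    using that by (metis compose_eq)
qed

text \<open>On real-valued functions, an associated vector-valued operator agrees with \<open>E\<close> because the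
  identity is a continuous functional.\<close>

lemma vector_markov_operator_real:
  fixes Z :: "'a \<Rightarrow> real"
  assumes EZ: "vector_markov_operator \<Omega>\<^sub>1 S\<^sub>1 S\<^sub>1Z \<Omega>\<^sub>2 S\<^sub>2 S\<^sub>2Z E EZ" and Z: "Z \<in> S\<^sub>1Z"
  shows "Z \<in> S\<^sub>1" and "\<omega> \<in> \<Omega>\<^sub>2 \<Longrightarrow> E Z \<omega> = EZ Z \<omega>"
proof -
  have "Z \<in> extensional \<Omega>\<^sub>1"
    using assms by (auto simp: vector_markov_operator_def weak_functions_def)
  then have "compose \<Omega>\<^sub>1 ((\<bullet>) 1) Z = Z"
    by (auto simp: compose_def fun_eq_iff extensional_def)
  then show "Z \<in> S\<^sub>1" and "\<omega> \<in> \<Omega>\<^sub>2 \<Longrightarrow> E Z \<omega> = EZ Z \<omega>"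
    using vector_markov_operator_functional[OF EZ inner_in_continuous_dual[of 1] Z] by simp_all
qed

theorem corollary4p11:
  fixes \<Omega>\<^sub>1 :: "'a set" and \<Omega>\<^sub>2 :: "'b set"
    and S\<^sub>1 :: "('a \<Rightarrow> real) set" and S\<^sub>2 :: "('b \<Rightarrow> real) set"
    and E :: "('a \<Rightarrow> real) \<Rightarrow> ('b \<Rightarrow> real)"
    and S\<^sub>1\<^sub>X :: "('a \<Rightarrow> real ^ 'd) set" and S\<^sub>2\<^sub>X :: "('b \<Rightarrow> real ^ 'd) set"
    and S\<^sub>1\<^sub>Y :: "('a \<Rightarrow> real) set" and S\<^sub>2\<^sub>Y :: "('b \<Rightarrow> real) set"
    and E\<^sub>X :: "('a \<Rightarrow> real ^ 'd) \<Rightarrow> ('b \<Rightarrow> real ^ 'd)"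
    and E\<^sub>Y :: "('a \<Rightarrow> real) \<Rightarrow> ('b \<Rightarrow> real)"
    and f :: "real ^ 'd \<Rightarrow> real"
    and X :: "'a \<Rightarrow> real ^ 'd"
  assumes "real_function_space \<Omega>\<^sub>1 S\<^sub>1" and "(\<lambda>\<omega>\<in>\<Omega>\<^sub>1. 1) \<in> S\<^sub>1"
    and "real_function_space \<Omega>\<^sub>2 S\<^sub>2" and "(\<lambda>\<omega>\<in>\<Omega>\<^sub>2. 1) \<in> S\<^sub>2"
    and "markov_operator \<Omega>\<^sub>1 S\<^sub>1 \<Omega>\<^sub>2 S\<^sub>2 E"
    and "vector_markov_operator \<Omega>\<^sub>1 S\<^sub>1 S\<^sub>1\<^sub>X \<Omega>\<^sub>2 S\<^sub>2 S\<^sub>2\<^sub>X E E\<^sub>X"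
    and "vector_markov_operator \<Omega>\<^sub>1 S\<^sub>1 S\<^sub>1\<^sub>Y \<Omega>\<^sub>2 S\<^sub>2 S\<^sub>2\<^sub>Y E E\<^sub>Y"
    and "convex_on UNIV f"
    and "X \<in> S\<^sub>1\<^sub>X" and "compose \<Omega>\<^sub>1 f X \<in> S\<^sub>1\<^sub>Y"
  shows "\<forall>\<omega>\<in>\<Omega>\<^sub>2. E\<^sub>Y (compose \<Omega>\<^sub>1 f X) \<omega> \<ge> f (E\<^sub>X X \<omega>)"
proof
  fix \<omega> assume \<omega>: "\<omega> \<in> \<Omega>\<^sub>2"
  note S1 = assms(1) and one = assms(2) and E = assms(5)
  let ?p = "E\<^sub>X X \<omega>"
  obtain v where v: "\<And>x. f ?p + v \<bullet> (x - ?p) \<le> f x"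
    using convex_on_UNIV_subgradient[OF assms(8)] by blast
  define c where "c = f ?p - v \<bullet> ?p"
  let ?c = "\<lambda>\<omega>\<in>\<Omega>\<^sub>1. c" and ?vX = "compose \<Omega>\<^sub>1 ((\<bullet>) v) X"
  let ?g = "\<lambda>\<omega>\<in>\<Omega>\<^sub>1. ?c \<omega> + ?vX \<omega>"
  note vX = vector_markov_operator_functional[OF assms(6) inner_in_continuous_dual[of v] assms(9)]
  note fX = vector_markov_operator_real[OF assms(7,10)]
  have c: "?c \<in> S\<^sub>1"
    by (rule real_function_space_const[OF S1 one])
  have lin: "linear_operator \<Omega>\<^sub>1 S\<^sub>1 \<Omega>\<^sub>2 S\<^sub>2 E"
    using E by (simp add: markov_operator_def)
  have "f ?p = c + v \<bullet> ?p"
    by (simp add: c_def)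
  also have "\<dots> = E ?c \<omega> + E ?vX \<omega>"
    using markov_operator_const[OF one E \<omega>] vX(2)[OF \<omega>] by simp
  also have "\<dots> = E ?g \<omega>"
    using linear_operator_add[OF lin c vX(1) \<omega>] by simp
  also have "\<dots> \<le> E (compose \<Omega>\<^sub>1 f X) \<omega>"
  proof (rule markov_operator_mono[OF S1 E _ fX(1) _ \<omega>])
    show "?g \<in> S\<^sub>1"
      by (rule real_function_space_add[OF S1 c vX(1)])
    show "?g \<eta> \<le> compose \<Omega>\<^sub>1 f X \<eta>" if "\<eta> \<in> \<Omega>\<^sub>1" for \<eta>
      using v[of "X \<eta>"] that by (simp add: c_def compose_eq inner_diff_right)
  qed
  also have "\<dots> = E\<^sub>Y (compose \<Omega>\<^sub>1 f X) \<omega>"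
    by (rule fX(2)[OF \<omega>])
  finally show "f ?p \<le> E\<^sub>Y (compose \<Omega>\<^sub>1 f X) \<omega>" .
qed

end
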